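(* Let $\alpha,\theta$ be ordinals with $1 \leq \alpha\leq \theta < \omega_1$. If $\theta<R(\alpha,3)$, then $\omega^{\theta}\nrightarrow_{cl} (\omega^{\alpha},3)^2$.
   Context: Ordinals carry their order topology. For a set $X$, $[X]^2$ denotes the set of two-element subsets of $X$. For ordinals $\alpha,\beta$ and $X \subseteq \alpha$ (subspace topology), $X$ is a closed copy of $\beta$ if there is a map $X \to \beta$ that is both an order-isomorphism and a homeomorphism. For ordinals $\alpha,\beta,\gamma$, $\gamma \rightarrow_{cl} (\alpha,\beta)^2$ means: for every $\mathfrak{c}:[\gamma]^2 \to \{0,1\}$ there is $X \subseteq \gamma$ which is either a closed copy of $\alpha$ with $\mathfrak{c}\equiv 0$ on $[X]^2$, or a closed copy of $\beta$ with $\mathfrak{c}\equiv 1$ on $[X]^2$; $\gamma \nrightarrow_{cl} (\alpha,\beta)^2$ is its negation. The classical partition relation $\gamma \rightarrow (\alpha,\beta)^2$ is defined in the same way except that $X$ is only required to be order-isomorphic to $\alpha$ (respectively $\beta$). $R(\alpha,3)$ denotes the classical ordinal Ramsey number, i.e. the least ordinal $\gamma$ with $\gamma \rightarrow (\alpha,3)^2$, where $3=\{0,1,2\}$. *)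

theory Defs
  imports "HOL-Analysis.Analysis" "HOL-Library.Ramsey" "HOL-Library.Multiset"
begin

no_notation elt_set_eq (infix \<open>=o\<close> 50)

notation
  ordLeq3 (infix \<open>\<le>o\<close> 50) and
  ordLess2 (infix \<open><o\<close> 50) and
  ordIso2 (infix \<open>=o\<close> 50)

text \<open>
  Ordinals are represented by well-order relations, compared by the library relations
  \<open>\<le>o\<close>, \<open><o\<close>, \<open>=o\<close>. The finite ordinal \<open>n\<close> is \<open>natLeq_on n\<close>, \<open>\<omega>\<close> is \<open>natLeq\<close> and
  \<open>\<omega>\<^sub>1\<close> is \<open>cardSuc natLeq\<close>.
\<close>

subsection \<open>Order topology and closed copies\<close>

text \<open>\<open>Field r\<close> is added to the open rays so that the whole space is open also when \<open>r\<close> has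
  just one point.\<close>

definition ord_topology :: "'a rel \<Rightarrow> 'a topology" where
  "ord_topology r =
     topology_generated_by (insert (Field r) (underS r ` Field r \<union> aboveS r ` Field r))"

definition closed_copy :: "'a rel \<Rightarrow> 'a set \<Rightarrow> 'b rel \<Rightarrow> bool" where
  "closed_copy \<gamma> X \<beta> \<longleftrightarrow> X \<subseteq> Field \<gamma> \<and>
     (\<exists>f. iso (Restr \<gamma> X) \<beta> f \<and>
          homeomorphic_map (subtopology (ord_topology \<gamma>) X) (ord_topology \<beta>) f)"

subsection \<open>Partition relations and ordinal Ramsey numbers\<close>

definition arrow_cl :: "'c rel \<Rightarrow> 'a rel \<Rightarrow> 'b rel \<Rightarrow> bool" where
  "arrow_cl \<gamma> \<alpha> \<beta> \<longleftrightarrow>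
     (\<forall>c \<in> [Field \<gamma>]\<^bsup>2\<^esup> \<rightarrow> {0, 1::nat}. \<exists>X \<subseteq> Field \<gamma>.
        (closed_copy \<gamma> X \<alpha> \<and> (\<forall>e \<in> [X]\<^bsup>2\<^esup>. c e = 0)) \<or>
        (closed_copy \<gamma> X \<beta> \<and> (\<forall>e \<in> [X]\<^bsup>2\<^esup>. c e = 1)))"

definition arrow :: "'c rel \<Rightarrow> 'a rel \<Rightarrow> 'b rel \<Rightarrow> bool" where
  "arrow \<gamma> \<alpha> \<beta> \<longleftrightarrow>
     (\<forall>c \<in> [Field \<gamma>]\<^bsup>2\<^esup> \<rightarrow> {0, 1::nat}. \<exists>X \<subseteq> Field \<gamma>.
        (Restr \<gamma> X =o \<alpha> \<and> (\<forall>e \<in> [X]\<^bsup>2\<^esup>. c e = 0)) \<or>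
        (Restr \<gamma> X =o \<beta> \<and> (\<forall>e \<in> [X]\<^bsup>2\<^esup>. c e = 1)))"

text \<open>\<open>is_Ramsey_number \<rho> \<alpha> \<beta>\<close> says that \<open>\<rho>\<close> represents \<open>R(\<alpha>,\<beta>)\<close>. Minimality is
  required only among well-orders on the type carrying \<open>\<rho>\<close>; this is minimality among all
  ordinals, see \<open>is_Ramsey_number_least\<close> below.\<close>

definition is_Ramsey_number :: "'c rel \<Rightarrow> 'a rel \<Rightarrow> 'b rel \<Rightarrow> bool" where
  "is_Ramsey_number \<rho> \<alpha> \<beta> \<longleftrightarrow>
     Well_order \<rho> \<and> arrow \<rho> \<alpha> \<beta> \<and>
     (\<forall>\<sigma> :: 'c rel. Well_order \<sigma> \<and> arrow \<sigma> \<alpha> \<beta> \<longrightarrow> \<rho> \<le>o \<sigma>)"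

lemma iso_Restr:
  assumes wo: "Well_order r" "Well_order s" and f: "iso r s f" and X: "X \<subseteq> Field r"
  shows "Restr r X =o Restr s (f ` X)"
proof -
  have bij: "bij_betw f (Field r) (Field s)"
    and cmp: "\<And>a b. \<lbrakk>a \<in> Field r; b \<in> Field r\<rbrakk> \<Longrightarrow> (a, b) \<in> r \<longleftrightarrow> (f a, f b) \<in> s"
    using f wo by (auto simp: iso_iff2)
  have Xs: "f ` X \<subseteq> Field s"
    using X bij by (auto simp: bij_betw_def)
  have F: "Field (Restr r X) = X" "Field (Restr s (f ` X)) = f ` X"
    using wo X Xs by (auto intro!: Refl_Field_Restr2 simp: order_on_defs)
  have inj: "inj_on f X"
    using X bij by (meson bij_betw_def inj_on_subset)
  have "(a, b) \<in> Restr r X \<longleftrightarrow> (f a, f b) \<in> Restr s (f ` X)" if "a \<in> X" "b \<in> X" for a b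
    using that cmp X by auto
  then have "iso (Restr r X) (Restr s (f ` X)) f"
    using F inj by (auto simp: iso_iff2 bij_betw_def)
  then show ?thesis
    using wo by (auto simp: ordIso_def Well_order_Restr)
qed

lemma arrow_ordIso:
  assumes iso: "r =o s" and ar: "arrow r \<alpha> \<beta>"
  shows "arrow s \<alpha> \<beta>"
  unfolding arrow_def
proof
  fix c :: "'b set \<Rightarrow> nat"
  assume c: "c \<in> [Field s]\<^bsup>2\<^esup> \<rightarrow> {0, 1}"
  obtain f where wo: "Well_order r" "Well_order s" and f: "iso r s f"
    using iso by (auto simp: ordIso_def)
  have bij: "bij_betw f (Field r) (Field s)"
    using f by (auto simp: iso_def)
  have inj: "inj_on f X" if "X \<subseteq> Field r" for X
    using that bij by (meson bij_betw_def inj_on_subset)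
  have img: "f ` e \<in> [f ` X]\<^bsup>2\<^esup>" if "X \<subseteq> Field r" "e \<in> [X]\<^bsup>2\<^esup>" for e X
    using that inj[of e] by (auto simp: nsets_def card_image)
  have "c (f ` e) \<in> {0, 1}" if "e \<in> [Field r]\<^bsup>2\<^esup>" for e
  proof -
    have "f ` e \<in> [Field s]\<^bsup>2\<^esup>"
      using img[OF subset_refl that] bij by (simp add: bij_betw_def)
    with c show ?thesis by (rule Pi_mem)
  qed
  then have cf: "(\<lambda>e. c (f ` e)) \<in> [Field r]\<^bsup>2\<^esup> \<rightarrow> {0, 1}"
    by (rule Pi_I)
  obtain X where X: "X \<subseteq> Field r"
    and d: "(Restr r X =o \<alpha> \<and> (\<forall>e \<in> [X]\<^bsup>2\<^esup>. c (f ` e) = 0)) \<or>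
            (Restr r X =o \<beta> \<and> (\<forall>e \<in> [X]\<^bsup>2\<^esup>. c (f ` e) = 1))"
    using bspec[OF ar[unfolded arrow_def] cf] by (elim exE conjE)
  have iX: "Restr s (f ` X) =o Restr r X"
    using iso_Restr[OF wo f X] by (rule ordIso_symmetric)
  have sub: "f ` X \<subseteq> Field s"
    using X bij by (auto simp: bij_betw_def)
  have pre: "\<exists>e \<in> [X]\<^bsup>2\<^esup>. e' = f ` e" if "e' \<in> [f ` X]\<^bsup>2\<^esup>" for e'
  proof -
    have "e' \<subseteq> f ` X"
      using that by (simp add: nsets_def)
    then obtain e where e: "e \<subseteq> X" "e' = f ` e"
      by (auto simp: subset_image_iff)
    have ie: "inj_on f e"
      using e X by (intro inj) auto
    then have "e \<in> [X]\<^bsup>2\<^esup>"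
      using that e by (simp add: nsets_def card_image finite_image_iff)
    with e show ?thesis by blast
  qed
  show "\<exists>X \<subseteq> Field s.
        (Restr s X =o \<alpha> \<and> (\<forall>e \<in> [X]\<^bsup>2\<^esup>. c e = 0)) \<or>
        (Restr s X =o \<beta> \<and> (\<forall>e \<in> [X]\<^bsup>2\<^esup>. c e = 1))"
  proof (intro exI[of _ "f ` X"] conjI)
    from d show "(Restr s (f ` X) =o \<alpha> \<and> (\<forall>e \<in> [f ` X]\<^bsup>2\<^esup>. c e = 0)) \<or>
        (Restr s (f ` X) =o \<beta> \<and> (\<forall>e \<in> [f ` X]\<^bsup>2\<^esup>. c e = 1))"
      using ordIso_transitive[OF iX, of \<alpha>] ordIso_transitive[OF iX, of \<beta>] pre by fast
  qed (rule sub)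
qed

lemma is_Ramsey_number_least:
  fixes \<rho> :: "'c rel" and \<sigma> :: "'d rel"
  assumes \<rho>: "is_Ramsey_number \<rho> \<alpha> \<beta>" and \<sigma>: "Well_order \<sigma>" "arrow \<sigma> \<alpha> \<beta>"
  shows "\<rho> \<le>o \<sigma>"
proof (rule ccontr)
  assume neg: "\<not> \<rho> \<le>o \<sigma>"
  have wo: "Well_order \<rho>"
    using \<rho> by (auto simp: is_Ramsey_number_def)
  then have less: "\<sigma> <o \<rho>"
    using neg \<sigma>(1) not_ordLeq_iff_ordLess by blast
  then obtain a where a: "a \<in> Field \<rho>" "\<sigma> =o Restr \<rho> (underS \<rho> a)"
    using wo \<sigma>(1) ordLess_iff_ordIso_Restr by blast
  have "arrow (Restr \<rho> (underS \<rho> a)) \<alpha> \<beta>"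
    using arrow_ordIso[OF a(2) \<sigma>(2)] .
  then have "\<rho> \<le>o Restr \<rho> (underS \<rho> a)"
    using \<rho> wo by (auto simp: is_Ramsey_number_def Well_order_Restr)
  then have "\<rho> \<le>o \<sigma>"
    using a(2) ordIso_symmetric ordLeq_ordIso_trans by blast
  with neg show False by blast
qed

subsection \<open>Powers of \<open>\<omega>\<close>\<close>

text \<open>\<open>\<omega>\<^bsup>\<theta>\<^esup>\<close> as the set of finitely supported functions \<open>\<theta> \<Rightarrow> \<omega>\<close>, ordered by their values
  at the largest argument where they differ. The function \<open>f\<close> stands for the Cantor normal form
  with coefficient \<open>f \<xi>\<close> at \<open>\<omega>\<^bsup>\<xi>\<^esup>\<close>.\<close>

definition fin_supp :: "'a rel \<Rightarrow> ('a \<Rightarrow> nat) set" where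
  "fin_supp \<theta> = {f. finite {\<xi>. f \<xi> \<noteq> 0} \<and> {\<xi>. f \<xi> \<noteq> 0} \<subseteq> Field \<theta>}"

definition omega_pow :: "'a rel \<Rightarrow> ('a \<Rightarrow> nat) rel" where
  "omega_pow \<theta> = {(f, g). f \<in> fin_supp \<theta> \<and> g \<in> fin_supp \<theta> \<and>
     (f = g \<or> (\<exists>\<mu> \<in> Field \<theta>. f \<mu> < g \<mu> \<and> (\<forall>\<xi> \<in> aboveS \<theta> \<mu>. f \<xi> = g \<xi>)))}"

lemma Field_omega_pow: "Field (omega_pow \<theta>) = fin_supp \<theta>"
  by (auto simp: Field_def omega_pow_def)

lemma Well_order_omega_pow:
  assumes wo: "Well_order \<theta>"
  shows "Well_order (omega_pow \<theta>)"
proof -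
  define lt where "lt f g \<longleftrightarrow> (\<exists>\<mu> \<in> Field \<theta>. f \<mu> < g \<mu> \<and> (\<forall>\<xi> \<in> aboveS \<theta> \<mu>. f \<xi> = g \<xi>))"
    for f g :: "'a \<Rightarrow> nat"
  have rel: "omega_pow \<theta> = {(f, g). f \<in> fin_supp \<theta> \<and> g \<in> fin_supp \<theta> \<and> (f = g \<or> lt f g)}"
    by (auto simp: omega_pow_def lt_def)
  have tot: "\<lbrakk>a \<in> Field \<theta>; b \<in> Field \<theta>; a \<noteq> b\<rbrakk> \<Longrightarrow> (a, b) \<in> \<theta> \<or> (b, a) \<in> \<theta>" for a b
    using wo by (auto simp: order_on_defs total_on_def)
  have tr: "trans \<theta>" and as: "antisym \<theta>" and wf: "wf (\<theta> - Id)"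
    using wo by (auto simp: order_on_defs)
  have irr: "\<not> lt f f" for f by (auto simp: lt_def)
  have lt_trans: "lt f h" if fg: "lt f g" and gh: "lt g h" for f g h
  proof -
    obtain m where m: "m \<in> Field \<theta>" "f m < g m" "\<And>\<xi>. \<xi> \<in> aboveS \<theta> m \<Longrightarrow> f \<xi> = g \<xi>"
      using fg by (auto simp: lt_def)
    obtain n where n: "n \<in> Field \<theta>" "g n < h n" "\<And>\<xi>. \<xi> \<in> aboveS \<theta> n \<Longrightarrow> g \<xi> = h \<xi>"
      using gh by (auto simp: lt_def)
    have up: "aboveS \<theta> b \<subseteq> aboveS \<theta> a" if "b \<in> aboveS \<theta> a" for a b
      using that tr as unfolding aboveS_def by (auto dest: transD antisymD)
    consider "m = n" | "n \<in> aboveS \<theta> m" | "m \<in> aboveS \<theta> n"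
      using tot[OF m(1) n(1)] by (auto simp: aboveS_def)
    then show ?thesis
    proof cases
      case 1
      then show ?thesis using m n unfolding lt_def by (intro bexI[of _ m]) auto
    next
      case 2
      then show ?thesis using m n up[OF 2] unfolding lt_def by (intro bexI[of _ n]) auto
    next
      case 3
      then show ?thesis using m n up[OF 3] unfolding lt_def by (intro bexI[of _ m]) auto
    qed
  qed
  have lt_total: "lt f g \<or> lt g f"
    if fg: "f \<in> fin_supp \<theta>" "g \<in> fin_supp \<theta>" "f \<noteq> g" for f g
  proof -
    let ?D = "{\<xi>. f \<xi> \<noteq> g \<xi>}"
    have sub: "?D \<subseteq> {\<xi>. f \<xi> \<noteq> 0} \<union> {\<xi>. g \<xi> \<noteq> 0}"
      by auto
    have D: "finite ?D" "?D \<subseteq> Field \<theta>" "?D \<noteq> {}"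
      using fg finite_subset[OF sub] sub by (auto simp: fin_supp_def fun_eq_iff simp del: neq0_conv)
    have "\<exists>m \<in> D. \<forall>x \<in> D. x \<notin> aboveS \<theta> m" if "finite D" "D \<noteq> {}" for D
      using that
    proof (induction rule: finite_ne_induct)
      case (singleton x)
      then show ?case by (auto simp: aboveS_def)
    next
      case (insert x F)
      then obtain m where m: "m \<in> F" "\<forall>y \<in> F. y \<notin> aboveS \<theta> m" by blast
      show ?case
      proof (cases "x \<in> aboveS \<theta> m")
        case True
        have "y \<notin> aboveS \<theta> x" if "y \<in> F" for y
          using m(2) that True tr as unfolding aboveS_def by (auto dest: transD antisymD)
        then show ?thesis by (auto simp: aboveS_def)
      next
        case False
        with m show ?thesis by auto
      qed
    qed
    then obtain m where m: "m \<in> ?D" "\<forall>x \<in> ?D. x \<notin> aboveS \<theta> m"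
      using D by blast
    then have "m \<in> Field \<theta>" "\<forall>x \<in> aboveS \<theta> m. f x = g x" "f m < g m \<or> g m < f m"
      using D by auto
    then show ?thesis unfolding lt_def by metis
  qed
  have "wf (omega_pow \<theta> - Id)"
  proof (rule wf_subset)
    show "wf (inv_image (mult (\<theta> - Id)) Abs_multiset)"
      using wf by (intro wf_inv_image wf_mult)
    show "omega_pow \<theta> - Id \<subseteq> inv_image (mult (\<theta> - Id)) Abs_multiset"
    proof (rule subrelI)
      fix f g
      assume "(f, g) \<in> omega_pow \<theta> - Id"
      then have f: "f \<in> fin_supp \<theta>" and g: "g \<in> fin_supp \<theta>" and "lt f g"
        by (auto simp: rel)
      then obtain m where m: "m \<in> Field \<theta>" "f m < g m" "\<forall>\<xi> \<in> aboveS \<theta> m. f \<xi> = g \<xi>"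
        by (auto simp: lt_def)
      let ?F = "Abs_multiset f" and ?G = "Abs_multiset g"
      have cnt: "count ?F = f" "count ?G = g"
        using f g by (auto simp: fin_supp_def)
      have mJ: "m \<in># ?G - ?F"
        using m(2) by (simp add: cnt in_diff_count)
      have "(k, m) \<in> \<theta> - Id" if "k \<in># ?F - ?G" for k
      proof -
        have k: "g k < f k" using that by (simp add: cnt in_diff_count)
        then have "k \<in> Field \<theta>" using f by (auto simp: fin_supp_def)
        moreover have "k \<noteq> m" using k m(2) by auto
        moreover have "k \<notin> aboveS \<theta> m" using k m(3) by auto
        ultimately show ?thesis using tot m(1) by (auto simp: aboveS_def)
      qed
      then have "((?F \<inter># ?G) + (?F - ?G), (?F \<inter># ?G) + (?G - ?F)) \<in> mult (\<theta> - Id)"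
        using mJ by (intro one_step_implies_mult) auto
      moreover have "(?F \<inter># ?G) + (?F - ?G) = ?F" "(?F \<inter># ?G) + (?G - ?F) = ?G"
        by (auto simp: multiset_eq_iff)
      ultimately show "(f, g) \<in> inv_image (mult (\<theta> - Id)) Abs_multiset"
        by simp
    qed
  qed
  moreover have "Refl (omega_pow \<theta>)"
    unfolding refl_on_def Field_omega_pow by (auto simp: rel)
  moreover have "trans (omega_pow \<theta>)"
    using lt_trans by (intro transI) (simp add: rel, metis)
  moreover have "antisym (omega_pow \<theta>)"
    using irr lt_trans by (intro antisymI) (simp add: rel, metis)
  moreover have "Total (omega_pow \<theta>)"
    unfolding total_on_def Field_omega_pow using lt_total by (auto simp: rel)
  moreover have "omega_pow \<theta> \<subseteq> Field (omega_pow \<theta>) \<times> Field (omega_pow \<theta>)"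
    by (auto simp: Field_def)
  ultimately show ?thesis
    by (simp add: order_on_defs)
qed

end

theory Submission
  imports Defs
begin

text \<open>
  Colour a pair of points of \<open>\<omega>\<^bsup>\<theta>\<^esup>\<close> by the colour that a witness of \<open>\<theta> \<nrightarrow> (\<alpha>,3)\<^sup>2\<close> gives to their
  Cantor--Bendixson ranks, and by \<open>0\<close> if the ranks agree. A triangle of colour \<open>1\<close> then projects
  to one in \<open>\<theta>\<close>. For a closed copy \<open>X\<close> of \<open>\<omega>\<^bsup>\<alpha>\<^esup>\<close> and \<open>\<gamma> < \<alpha>\<close>, let \<open>m \<gamma>\<close> be the least rank in
  \<open>\<omega>\<^bsup>\<theta>\<^esup>\<close> of a point that has rank \<open>\<gamma>\<close> in \<open>X\<close>. A point of rank \<open>\<delta> > \<gamma>\<close> in \<open>X\<close> is a limit of points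
  of rank \<open>\<gamma>\<close> in \<open>X\<close>, so \<open>m\<close> is strictly increasing; if \<open>X\<close> is homogeneous of colour \<open>0\<close>, the range
  of \<open>m\<close> is a homogeneous subset of \<open>\<theta>\<close> of type \<open>\<alpha>\<close>.
\<close>

section \<open>Left neighbourhoods in the order topology\<close>

lemma Well_order_cases:
  assumes "Well_order r" "a \<in> Field r" "b \<in> Field r"
  obtains "a = b" | "a \<in> underS r b" "b \<in> aboveS r a" | "b \<in> underS r a" "a \<in> aboveS r b"
  using assms by (auto simp: order_on_defs total_on_def underS_def aboveS_def)

text \<open>Induction over the generation of \<open>U\<close> from the subbasis. An intersection
  takes the larger of two left ends. A lower ray around \<open>a\<close>, like the whole space,
  contains all of \<open>underS r a\<close>; an upper ray around \<open>a\<close> supplies its own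
  end point as \<open>h\<close>.\<close>

lemma ord_topology_left_interval:
  assumes wo: "Well_order r" and U: "openin (ord_topology r) U" and a: "a \<in> U" "underS r a \<noteq> {}"
  shows "\<exists>h \<in> underS r a. aboveS r h \<inter> underS r a \<subseteq> U"
proof -
  have tr: "trans r" and as: "antisym r"
    using wo by (auto simp: order_on_defs)
  let ?B = "insert (Field r) (underS r ` Field r \<union> aboveS r ` Field r)"
  have "generate_topology_on ?B U"
    using U unfolding ord_topology_def openin_topology_generated_by_iff .
  then show ?thesis
    using a
  proof (induction)
    case Empty
    then show ?case by simp
  next
    case (Int U V)
    obtain h where h: "h \<in> underS r a" "aboveS r h \<inter> underS r a \<subseteq> U"
      using Int by auto
    obtain k where k: "k \<in> underS r a" "aboveS r k \<inter> underS r a \<subseteq> V"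
      using Int by auto
    have hk: "h \<in> Field r" "k \<in> Field r"
      using h k by (auto simp: underS_def Field_def)
    have up: "aboveS r y \<subseteq> aboveS r x" if "x \<in> underS r y" for x y
      using that tr as unfolding aboveS_def underS_def by (auto dest: transD antisymD)
    show ?case
      using wo hk by (rule Well_order_cases) (use h k up in blast)+
  next
    case (UN K)
    then show ?case by blast
  next
    case (Basis s)
    then consider "s = Field r" | b where "s = underS r b" | b where "s = aboveS r b"
      by auto
    then show ?case
    proof cases
      case 1
      then show ?thesis using Basis by (auto simp: underS_def Field_def)
    next
      case (2 b)
      then have "underS r a \<subseteq> s"
        using Basis tr as unfolding underS_def by (auto dest: transD antisymD)
      then show ?thesis using Basis by blast
    next
      case (3 b)
      then have "b \<in> underS r a"
        using Basis by (auto simp: underS_def aboveS_def)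
      with 3 show ?thesis by blast
    qed
  qed
qed

lemma openin_aboveS: "a \<in> Field r \<Longrightarrow> openin (ord_topology r) (aboveS r a)"
  unfolding ord_topology_def by (rule topology_generated_by_Basis) auto

section \<open>Cantor-Bendixson ranks in powers of \<omega>\<close>

lemma underS_omega_pow:
  "f \<in> underS (omega_pow \<theta>) g \<longleftrightarrow> f \<in> fin_supp \<theta> \<and> g \<in> fin_supp \<theta> \<and>
     (\<exists>\<mu> \<in> Field \<theta>. f \<mu> < g \<mu> \<and> (\<forall>\<xi> \<in> aboveS \<theta> \<mu>. f \<xi> = g \<xi>))"
  by (auto simp: underS_def omega_pow_def)

lemma aboveS_omega_pow:
  "g \<in> aboveS (omega_pow \<theta>) f \<longleftrightarrow> f \<in> underS (omega_pow \<theta>) g"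
  by (auto simp: underS_def aboveS_def)

text \<open>The rank of a nonzero ordinal is the least exponent in its Cantor normal form. The empty
  normal form \<open>0\<close> is an isolated point and gets the least element of \<open>\<theta>\<close>.\<close>

definition cb_rank :: "'a rel \<Rightarrow> ('a \<Rightarrow> nat) \<Rightarrow> 'a" where
  "cb_rank \<theta> f = wo_rel.minim \<theta> (if f = (\<lambda>_. 0) then Field \<theta> else {\<xi>. f \<xi> \<noteq> 0})"

lemma cb_rank_in_Field:
  assumes "Well_order \<theta>" "Field \<theta> \<noteq> {}" "f \<in> fin_supp \<theta>"
  shows "cb_rank \<theta> f \<in> Field \<theta>"
proof -
  interpret wo_rel \<theta> using assms(1) by (simp add: wo_rel_def)
  show ?thesis
    using assms(2,3) unfolding cb_rank_def
    by (intro minim_inField) (auto simp: fin_supp_def fun_eq_iff)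
qed

lemma cb_rank_nonzero:
  assumes "Well_order \<theta>" "f \<in> fin_supp \<theta>" "f \<noteq> (\<lambda>_. 0)"
  shows "f (cb_rank \<theta> f) \<noteq> 0" "\<And>\<xi>. f \<xi> \<noteq> 0 \<Longrightarrow> (cb_rank \<theta> f, \<xi>) \<in> \<theta>"
proof -
  interpret wo_rel \<theta> using assms(1) by (simp add: wo_rel_def)
  have sub: "{\<xi>. f \<xi> \<noteq> 0} \<subseteq> Field \<theta>" and ne: "{\<xi>. f \<xi> \<noteq> 0} \<noteq> {}"
    using assms by (auto simp: fin_supp_def fun_eq_iff)
  show "f (cb_rank \<theta> f) \<noteq> 0"
    using minim_in[OF sub ne] assms(3) by (simp add: cb_rank_def)
  show "(cb_rank \<theta> f, \<xi>) \<in> \<theta>" if "f \<xi> \<noteq> 0" for \<xi>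
    using minim_least[OF sub] that assms(3) by (simp add: cb_rank_def)
qed

lemma cb_rank_eqI:
  assumes wo: "Well_order \<theta>" and f: "f \<in> fin_supp \<theta>" and \<gamma>: "f \<gamma> \<noteq> 0"
    and below: "\<And>\<xi>. \<xi> \<in> underS \<theta> \<gamma> \<Longrightarrow> f \<xi> = 0"
  shows "cb_rank \<theta> f = \<gamma>"
proof -
  have "f \<noteq> (\<lambda>_. 0)" using \<gamma> by auto
  note cb = cb_rank_nonzero[OF wo f this]
  show ?thesis using cb(1) cb(2)[OF \<gamma>] below[of "cb_rank \<theta> f"] by (auto simp: underS_def)
qed

text \<open>If the last term of the normal form of \<open>x\<close> has exponent \<rho>, then
  \<open>x\<close> is the sum of some \<open>y\<close> and the \<rho>-th power of \<omega>. The
  points strictly between arise from \<open>y\<close> by adding a nonzero ordinal below that power,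
  so their last exponent is below \<rho>.\<close>

lemma cb_rank_less_near:
  assumes wo: "Well_order \<theta>" and x: "x \<in> fin_supp \<theta>" "x \<noteq> (\<lambda>_. 0)"
  obtains y where "y \<in> underS (omega_pow \<theta>) x"
    "\<And>z. z \<in> aboveS (omega_pow \<theta>) y \<Longrightarrow> z \<in> underS (omega_pow \<theta>) x \<Longrightarrow>
       cb_rank \<theta> z \<in> underS \<theta> (cb_rank \<theta> x)"
proof
  define \<rho> where "\<rho> = cb_rank \<theta> x"
  note cb = cb_rank_nonzero[OF wo x, folded \<rho>_def]
  have \<rho>: "\<rho> \<in> Field \<theta>" using cb(1) x(1) by (auto simp: fin_supp_def)
  define y where "y = x(\<rho> := x \<rho> - 1)"
  have "{\<xi>. y \<xi> \<noteq> 0} \<subseteq> {\<xi>. x \<xi> \<noteq> 0}" by (auto simp: y_def)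
  then have yf: "y \<in> fin_supp \<theta>"
    using x(1) finite_subset unfolding fin_supp_def by blast
  have y\<rho>: "y \<rho> = x \<rho> - 1" and y_other: "\<And>\<xi>. \<xi> \<noteq> \<rho> \<Longrightarrow> y \<xi> = x \<xi>"
    by (auto simp: y_def)
  have lt: "y \<rho> < x \<rho>" "\<forall>\<xi> \<in> aboveS \<theta> \<rho>. y \<xi> = x \<xi>"
    using cb(1) y_other by (auto simp: y\<rho> aboveS_def)
  then show "y \<in> underS (omega_pow \<theta>) x"
    using yf x(1) \<rho> by (auto simp: underS_omega_pow)
  fix z
  assume yz: "z \<in> aboveS (omega_pow \<theta>) y" and zx: "z \<in> underS (omega_pow \<theta>) x"
  obtain \<mu> where zf: "z \<in> fin_supp \<theta>"
    and \<mu>: "\<mu> \<in> Field \<theta>" "y \<mu> < z \<mu>" "\<And>\<xi>. \<xi> \<in> aboveS \<theta> \<mu> \<Longrightarrow> y \<xi> = z \<xi>"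
    using yz by (auto simp: aboveS_omega_pow underS_omega_pow)
  obtain \<nu> where \<nu>: "\<nu> \<in> Field \<theta>" "z \<nu> < x \<nu>" "\<And>\<xi>. \<xi> \<in> aboveS \<theta> \<nu> \<Longrightarrow> z \<xi> = x \<xi>"
    using zx by (auto simp: underS_omega_pow)
  have as: "antisym \<theta>" and tr: "trans \<theta>" using wo by (auto simp: order_on_defs)
  have \<rho>\<nu>: "(\<rho>, \<nu>) \<in> \<theta>" using cb(2) \<nu>(2) by simp
  \<comment> \<open>At an exponent other than \<rho> the functions \<open>x\<close> and
    \<open>y\<close> agree, so a drop of \<open>z\<close> below \<open>x\<close> at such a \<nu>
    would also put \<open>z\<close> below \<open>y\<close>.\<close>
  have "\<nu> = \<rho>"
  proof (rule ccontr)
    assume ne: "\<nu> \<noteq> \<rho>"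
    show False
      using wo \<mu>(1) \<nu>(1)
    proof (rule Well_order_cases)
      assume "\<mu> = \<nu>"
      then show False using \<mu>(2) \<nu>(2) y_other[OF ne] by simp
    next
      assume "\<nu> \<in> aboveS \<theta> \<mu>"
      then show False using \<mu>(3) \<nu>(2) y_other[OF ne] by fastforce
    next
      assume *: "\<mu> \<in> aboveS \<theta> \<nu>"
      then have "\<mu> \<noteq> \<rho>" using \<rho>\<nu> as ne by (auto simp: aboveS_def dest: antisymD)
      then show False using \<nu>(3)[OF *] \<mu>(2) y_other by simp
    qed
  qed
  \<comment> \<open>There is no room at \<rho> itself, since \<open>y \<rho>\<close> and
    \<open>x \<rho>\<close> differ by one, and above \<rho> all three functions agree. So
    \<open>z\<close> exceeds \<open>y\<close> through a term below \<rho>.\<close>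
  have \<mu>\<rho>: "\<mu> \<in> underS \<theta> \<rho>"
    using wo \<mu>(1) \<rho>
  proof (rule Well_order_cases)
    assume "\<mu> = \<rho>"
    then show ?thesis using \<mu>(2) \<nu>(2) \<open>\<nu> = \<rho>\<close> y\<rho> by simp
  next
    assume *: "\<mu> \<in> aboveS \<theta> \<rho>"
    then show ?thesis using \<nu>(3)[of \<mu>] \<mu>(2) \<open>\<nu> = \<rho>\<close> y_other[of \<mu>] by (simp add: aboveS_def)
  qed
  have z0: "z \<mu> \<noteq> 0" using \<mu>(2) by simp
  then have "z \<noteq> (\<lambda>_. 0)" by auto
  from cb_rank_nonzero(2)[OF wo zf this z0] \<mu>\<rho> show "cb_rank \<theta> z \<in> underS \<theta> (cb_rank \<theta> x)"
    unfolding \<rho>_def[symmetric] using tr as by (auto simp: underS_def dest: transD antisymD)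
qed

text \<open>The last exponent of \<open>f\<close> is \<delta>, so \<open>h\<close> falls below
  \<open>f\<close> at an exponent that is at least \<delta>, hence above \<gamma>. Changing
  \<open>h\<close> at and below \<gamma> therefore keeps it below \<open>f\<close>.\<close>

lemma cb_rank_cofinal:
  assumes wo: "Well_order \<alpha>" and \<delta>: "f \<in> fin_supp \<alpha>" "f \<noteq> (\<lambda>_. 0)" "cb_rank \<alpha> f = \<delta>"
    and \<gamma>: "\<gamma> \<in> underS \<alpha> \<delta>" and h: "h \<in> underS (omega_pow \<alpha>) f"
  shows "\<exists>k \<in> aboveS (omega_pow \<alpha>) h \<inter> underS (omega_pow \<alpha>) f. k \<noteq> (\<lambda>_. 0) \<and> cb_rank \<alpha> k = \<gamma>"
proof -
  have as: "antisym \<alpha>" and tr: "trans \<alpha>" using wo by (auto simp: order_on_defs)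
  note cb = cb_rank_nonzero[OF wo \<delta>(1,2), unfolded \<delta>(3)]
  have \<gamma>F: "\<gamma> \<in> Field \<alpha>" using \<gamma> by (auto simp: underS_def Field_def)
  obtain \<mu> where hf: "h \<in> fin_supp \<alpha>"
    and \<mu>: "\<mu> \<in> Field \<alpha>" "h \<mu> < f \<mu>" "\<And>\<xi>. \<xi> \<in> aboveS \<alpha> \<mu> \<Longrightarrow> h \<xi> = f \<xi>"
    using h by (auto simp: underS_omega_pow)
  have "(\<delta>, \<mu>) \<in> \<alpha>" using cb(2) \<mu>(2) by simp
  then have \<gamma>\<mu>: "\<mu> \<in> aboveS \<alpha> \<gamma>"
    using \<gamma> tr as by (auto simp: underS_def aboveS_def dest: transD antisymD)
  \<comment> \<open>The normal form of \<open>h\<close> is cut off below \<gamma>, which yields rank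
    \<gamma>, and its coefficient at \<gamma> is raised by one, which makes \<open>k\<close> larger
    than \<open>h\<close> despite the cut.\<close>
  define k where "k \<xi> = (if \<xi> = \<gamma> then Suc (h \<gamma>) else if \<xi> \<in> aboveS \<alpha> \<gamma> then h \<xi> else 0)" for \<xi>
  have "{\<xi>. k \<xi> \<noteq> 0} \<subseteq> insert \<gamma> {\<xi>. h \<xi> \<noteq> 0}" by (auto simp: k_def)
  moreover have "finite (insert \<gamma> {\<xi>. h \<xi> \<noteq> 0})" "insert \<gamma> {\<xi>. h \<xi> \<noteq> 0} \<subseteq> Field \<alpha>"
    using hf \<gamma>F by (auto simp: fin_supp_def)
  ultimately have kf: "k \<in> fin_supp \<alpha>"
    unfolding fin_supp_def using finite_subset by blast
  have k\<gamma>: "k \<gamma> = Suc (h \<gamma>)" and k_above: "\<And>\<xi>. \<xi> \<in> aboveS \<alpha> \<gamma> \<Longrightarrow> k \<xi> = h \<xi>"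
    by (auto simp: k_def aboveS_def)
  have "k \<in> aboveS (omega_pow \<alpha>) h"
    unfolding aboveS_omega_pow underS_omega_pow
    using hf kf \<gamma>F k\<gamma> k_above by (intro conjI bexI[of _ \<gamma>]) auto
  moreover have "k \<in> underS (omega_pow \<alpha>) f"
  proof -
    have "k \<mu> < f \<mu>" using \<mu>(2) k_above[OF \<gamma>\<mu>] by simp
    moreover have "k \<xi> = f \<xi>" if "\<xi> \<in> aboveS \<alpha> \<mu>" for \<xi>
    proof -
      have "\<xi> \<in> aboveS \<alpha> \<gamma>"
        using that \<gamma>\<mu> tr as by (auto simp: aboveS_def dest: transD antisymD)
      then show ?thesis using k_above \<mu>(3)[OF that] by simp
    qed
    ultimately show ?thesis
      using kf \<delta>(1) \<mu>(1) by (auto simp: underS_omega_pow)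
  qed
  moreover have "cb_rank \<alpha> k = \<gamma>"
  proof (rule cb_rank_eqI[OF wo kf])
    show "k \<xi> = 0" if "\<xi> \<in> underS \<alpha> \<gamma>" for \<xi>
      using that as by (auto simp: k_def underS_def aboveS_def dest: antisymD)
  qed (simp add: k\<gamma>)
  moreover have "k \<noteq> (\<lambda>_. 0)" using k\<gamma> by auto
  ultimately show ?thesis by blast
qed

section \<open>Ranks met by a closed copy\<close>

lemma strict_mono_Restr_ordIso:
  assumes wo: "Well_order \<alpha>" "Well_order \<theta>"
    and m: "\<And>a b. a \<in> underS \<alpha> b \<Longrightarrow> m a \<in> underS \<theta> (m b)"
    and F: "m ` Field \<alpha> \<subseteq> Field \<theta>"
  shows "Restr \<theta> (m ` Field \<alpha>) =o \<alpha>"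
proof -
  have as: "antisym \<theta>" and re: "Refl \<alpha>" "Refl \<theta>"
    using wo by (auto simp: order_on_defs)
  have FR: "Field (Restr \<theta> (m ` Field \<alpha>)) = m ` Field \<alpha>"
    using re F by (intro Refl_Field_Restr2)
  have inj: "inj_on m (Field \<alpha>)"
  proof (rule inj_onI)
    fix a b assume "a \<in> Field \<alpha>" "b \<in> Field \<alpha>" "m a = m b"
    with wo(1) show "a = b"
      by (elim Well_order_cases[of \<alpha> a b]) (use m[of a b] m[of b a] in \<open>auto simp: underS_def\<close>)
  qed
  have cmp: "(a, b) \<in> \<alpha> \<longleftrightarrow> (m a, m b) \<in> \<theta>" if ab: "a \<in> Field \<alpha>" "b \<in> Field \<alpha>" for a b
    using wo(1) ab
  proof (rule Well_order_cases)
    assume "a = b"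
    then show ?thesis using re ab F by (auto simp: refl_on_def)
  next
    assume "a \<in> underS \<alpha> b"
    then show ?thesis using m[of a b] by (auto simp: underS_def)
  next
    assume *: "b \<in> underS \<alpha> a"
    then have "(a, b) \<notin> \<alpha>" using wo(1) by (auto simp: underS_def order_on_defs dest: antisymD)
    moreover have "(m a, m b) \<notin> \<theta>" using m[OF *] as by (auto simp: underS_def dest: antisymD)
    ultimately show ?thesis by simp
  qed
  have "iso \<alpha> (Restr \<theta> (m ` Field \<alpha>)) m"
    unfolding iso_iff2 FR using inj cmp by (auto simp: bij_betw_def)
  then have "\<alpha> =o Restr \<theta> (m ` Field \<alpha>)"
    using wo Well_order_Restr by (auto simp: ordIso_def)
  then show ?thesis by (rule ordIso_symmetric)
qed

text \<open>Points of one rank in \<open>X\<close> may have many ranks in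
  \<open>omega_pow \<theta>\<close>; minima make the levels of \<open>X\<close> comparable. That
  \<open>M\<close> consists of ranks of points of \<open>X\<close> lets homogeneity pass from
  \<open>X\<close> to \<open>M\<close>.\<close>

lemma closed_copy_omega_pow_ranks:
  assumes wo: "Well_order \<alpha>" "Well_order \<theta>" and ne: "Field \<theta> \<noteq> {}"
    and cc: "closed_copy (omega_pow \<theta>) X (omega_pow \<alpha>)"
  obtains M where "M \<subseteq> cb_rank \<theta> ` X" "Restr \<theta> M =o \<alpha>"
proof -
  interpret T: wo_rel \<theta> using wo(2) by (simp add: wo_rel_def)
  let ?P = "omega_pow \<theta>" and ?Q = "omega_pow \<alpha>"
  have woP: "Well_order ?P" and woQ: "Well_order ?Q"
    using wo by (auto intro: Well_order_omega_pow)
  obtain \<phi> where X: "X \<subseteq> fin_supp \<theta>" and iso: "iso (Restr ?P X) ?Q \<phi>"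
    and hom: "homeomorphic_map (subtopology (ord_topology ?P) X) (ord_topology ?Q) \<phi>"
    using cc by (auto simp: closed_copy_def Field_omega_pow)
  have FR: "Field (Restr ?P X) = X"
    using woP X by (intro Refl_Field_Restr2) (auto simp: order_on_defs Field_omega_pow)
  have bij: "bij_betw \<phi> X (fin_supp \<alpha>)"
    and cmp: "\<And>x y. x \<in> X \<Longrightarrow> y \<in> X \<Longrightarrow> (x, y) \<in> ?P \<longleftrightarrow> (\<phi> x, \<phi> y) \<in> ?Q"
    using iso unfolding iso_iff2 FR by (auto simp: Field_omega_pow)
  have onto: "\<exists>x \<in> X. \<phi> x = f" if "f \<in> fin_supp \<alpha>" for f
  proof -
    have "f \<in> \<phi> ` X" using that bij by (simp add: bij_betw_def)
    then show ?thesis by (rule imageE) (rule bexI, rule sym)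
  qed
  have under: "x \<in> underS ?P y \<longleftrightarrow> \<phi> x \<in> underS ?Q (\<phi> y)" if "x \<in> X" "y \<in> X" for x y
    using that cmp[OF that] bij by (auto simp: underS_def bij_betw_def inj_on_def)
  \<comment> \<open>The rank inside \<open>X\<close> is read off through \<phi>. The zero function
    has only a default rank and is left out, so that \<open>cb_rank_cofinal\<close> can be applied
    at the image of a member.\<close>
  define S where "S \<gamma> = {x \<in> X. \<phi> x \<noteq> (\<lambda>_. 0) \<and> cb_rank \<alpha> (\<phi> x) = \<gamma>}" for \<gamma>
  have S_ne: "S \<gamma> \<noteq> {}" if "\<gamma> \<in> Field \<alpha>" for \<gamma>
  proof -
    \<comment> \<open>This is the \<gamma>-th power of \<omega>, the least nonzero ordinal of rank
      \<gamma>.\<close>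
    define e where "e = (\<lambda>\<xi>. if \<xi> = \<gamma> then 1 else 0 :: nat)"
    have "{\<xi>. e \<xi> \<noteq> 0} = {\<gamma>}" by (auto simp: e_def)
    then have ef: "e \<in> fin_supp \<alpha>" using that by (simp add: fin_supp_def)
    moreover have "cb_rank \<alpha> e = \<gamma>"
      by (rule cb_rank_eqI[OF wo(1) ef]) (auto simp: e_def underS_def)
    moreover have "e \<noteq> (\<lambda>_. 0)" by (auto simp: e_def fun_eq_iff)
    ultimately show ?thesis using onto[of e] by (auto simp: S_def)
  qed
  define m where "m \<gamma> = T.minim (cb_rank \<theta> ` S \<gamma>)" for \<gamma>
  have sub: "cb_rank \<theta> ` S \<gamma> \<subseteq> Field \<theta>" for \<gamma>
    using X cb_rank_in_Field[OF wo(2) ne] by (auto simp: S_def)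
  have m_in: "m \<gamma> \<in> cb_rank \<theta> ` S \<gamma>" if "\<gamma> \<in> Field \<alpha>" for \<gamma>
    unfolding m_def using sub S_ne[OF that] by (intro T.minim_in) auto
  have m_least: "(m \<gamma>, cb_rank \<theta> x) \<in> \<theta>" if "x \<in> S \<gamma>" for \<gamma> x
    unfolding m_def using sub that by (intro T.minim_least) auto
  have tr: "trans \<theta>" and as: "antisym \<theta>"
    using wo(2) by (auto simp: order_on_defs)
  have incr: "m \<gamma> \<in> underS \<theta> (m \<delta>)" if \<gamma>\<delta>: "\<gamma> \<in> underS \<alpha> \<delta>" for \<gamma> \<delta>
  proof -
    have "\<delta> \<in> Field \<alpha>" using \<gamma>\<delta> by (auto simp: underS_def Field_def)
    then obtain x where x: "x \<in> S \<delta>" and mx: "m \<delta> = cb_rank \<theta> x"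
      using m_in by blast
    have xX: "x \<in> X" and \<phi>x: "\<phi> x \<in> fin_supp \<alpha>" "\<phi> x \<noteq> (\<lambda>_. 0)" "cb_rank \<alpha> (\<phi> x) = \<delta>"
      using x bij by (auto simp: S_def bij_betw_def)
    have zero: "(\<lambda>_. 0) \<in> underS (omega_pow r) f"
      if wr: "Well_order r" and f: "f \<in> fin_supp r" "f \<noteq> (\<lambda>_. 0)" for r :: "'r rel" and f
    proof -
      have z: "(\<lambda>_. 0) \<in> fin_supp r" by (simp add: fin_supp_def)
      have "(\<lambda>_. 0) \<in> Field (omega_pow r)" "f \<in> Field (omega_pow r)"
        using z f by (simp_all add: Field_omega_pow)
      with Well_order_omega_pow[OF wr] show ?thesis
        by (rule Well_order_cases) (use f in \<open>auto simp: underS_def omega_pow_def\<close>)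
    qed
    \<comment> \<open>The image of \<open>x\<close> is not the least point of
      \<open>omega_pow \<alpha>\<close>, so \<open>X\<close> has a point below \<open>x\<close>.
      Hence the rank of \<open>x\<close> is a true exponent, not the default.\<close>
    have nz: "x \<noteq> (\<lambda>_. 0)"
    proof
      assume x0: "x = (\<lambda>_. 0)"
      have z: "(\<lambda>_. 0) \<in> underS ?Q (\<phi> x)" by (rule zero[OF wo(1) \<phi>x(1,2)])
      have "(\<lambda>_. 0) \<in> fin_supp \<alpha>" by (simp add: fin_supp_def)
      then obtain w where w: "w \<in> X" "\<phi> w = (\<lambda>_. 0)" using onto by metis
      then have "w \<in> underS ?P x" using under[OF w(1) xX] z by simp
      then show False unfolding x0 by (auto simp: underS_omega_pow)
    qed
    obtain y where y: "y \<in> underS ?P x"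
      and near: "\<And>z. z \<in> aboveS ?P y \<Longrightarrow> z \<in> underS ?P x \<Longrightarrow>
        cb_rank \<theta> z \<in> underS \<theta> (cb_rank \<theta> x)"
      using cb_rank_less_near[OF wo(2) _ nz] X xX by blast
    have yF: "y \<in> Field ?P" using y by (auto simp: underS_def Field_def)
    \<comment> \<open>Only the lower bound \<open>y\<close> is carried over by the topology; the
      upper bound \<open>x\<close> is recovered from the order isomorphism.\<close>
    have "openin (subtopology (ord_topology ?P) X) (aboveS ?P y \<inter> X)"
      using openin_aboveS[OF yF] by (auto simp: openin_subtopology)
    then have op: "openin (ord_topology ?Q) (\<phi> ` (aboveS ?P y \<inter> X))"
      using hom homeomorphic_imp_open_map open_map_def by blast
    have "x \<in> aboveS ?P y" using y by (auto simp: underS_def aboveS_def)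
    then have \<phi>xU: "\<phi> x \<in> \<phi> ` (aboveS ?P y \<inter> X)" using xX by blast
    have "underS ?Q (\<phi> x) \<noteq> {}" using zero[OF wo(1) \<phi>x(1,2)] by blast
    then obtain h where h: "h \<in> underS ?Q (\<phi> x)"
      and hU: "aboveS ?Q h \<inter> underS ?Q (\<phi> x) \<subseteq> \<phi> ` (aboveS ?P y \<inter> X)"
      using ord_topology_left_interval[OF woQ op \<phi>xU] by blast
    \<comment> \<open>Pulled back along \<phi>, this \<open>k\<close> becomes a point
      \<open>z\<close> of \<open>S \<gamma>\<close> strictly between \<open>y\<close> and
      \<open>x\<close>. Its rank bounds \<open>m \<gamma>\<close> from above and is below the rank
      of \<open>x\<close>, which is \<open>m \<delta>\<close>.\<close>
    obtain k where k: "k \<in> aboveS ?Q h" "k \<in> underS ?Q (\<phi> x)" "k \<noteq> (\<lambda>_. 0)" "cb_rank \<alpha> k = \<gamma>"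
      using cb_rank_cofinal[OF wo(1) \<phi>x \<gamma>\<delta> h] by blast
    then obtain z where z: "z \<in> X" "z \<in> aboveS ?P y" "\<phi> z = k" using hU by blast
    then have "z \<in> underS ?P x" using under[OF z(1) xX] k by simp
    then have "cb_rank \<theta> z \<in> underS \<theta> (cb_rank \<theta> x)" using near z by blast
    moreover have "z \<in> S \<gamma>" using z k by (auto simp: S_def)
    then have "(m \<gamma>, cb_rank \<theta> z) \<in> \<theta>" by (rule m_least)
    ultimately show ?thesis
      unfolding mx using tr as by (auto simp: underS_def dest: transD antisymD)
  qed
  have "m ` Field \<alpha> \<subseteq> cb_rank \<theta> ` X"
    using m_in by (auto simp: S_def)
  moreover have "Restr \<theta> (m ` Field \<alpha>) =o \<alpha>"
    using m_in sub by (intro strict_mono_Restr_ordIso wo incr) auto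
  ultimately show ?thesis by (rule that)
qed

section \<open>Finite suborders\<close>

lemma Restr_ordIso_natLeq_on_card:
  assumes "Well_order r" "Y \<subseteq> Field r" "finite Y"
  shows "Restr r Y =o natLeq_on (card Y)"
proof -
  let ?N = "{x. x < card Y}"
  \<comment> \<open>Any two well-orders on a finite set are isomorphic, so both sides can be
    exchanged for the cardinal orders of their fields, which a bijection compares.\<close>
  have "well_order_on ?N (natLeq_on (card Y))"
    using natLeq_on_Well_order[of "card Y"] unfolding Field_natLeq_on .
  then have 1: "card_of ?N =o natLeq_on (card Y)"
    using finite_well_order_on_ordIso[OF _ card_of_well_order_on] by blast
  have "Field (Restr r Y) = Y"
    using assms by (intro Refl_Field_Restr2) (auto simp: order_on_defs)
  then have "well_order_on Y (Restr r Y)"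
    using Well_order_Restr[OF assms(1), of Y] by simp
  then have 2: "Restr r Y =o card_of Y"
    by (rule finite_well_order_on_ordIso[OF assms(3) _ card_of_well_order_on])
  have "card Y = card ?N" by simp
  then have "\<exists>g. bij_betw g Y ?N"
    by (rule finite_same_card_bij[OF assms(3), rotated]) simp
  then have "card_of Y =o card_of ?N"
    by (rule iffD1[OF card_of_ordIso])
  from ordIso_transitive[OF ordIso_transitive[OF 2 this] 1] show ?thesis .
qed

lemma closed_copy_natLeq_on_card:
  assumes wo: "Well_order \<gamma>" and cc: "closed_copy \<gamma> X (natLeq_on n)"
  shows "finite X" "card X = n"
proof -
  obtain f where X: "X \<subseteq> Field \<gamma>" and f: "iso (Restr \<gamma> X) (natLeq_on n) f"
    using cc by (auto simp: closed_copy_def)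
  have "Field (Restr \<gamma> X) = X"
    using wo X by (intro Refl_Field_Restr2) (auto simp: order_on_defs)
  then have "bij_betw f X {x. x < n}"
    using f by (simp add: iso_def Field_natLeq_on)
  then show "finite X" "card X = n"
    using bij_betw_finite[of f X] bij_betw_same_card[of f X] by auto
qed

section \<open>The colouring pulled back along the rank\<close>

theorem theorem1p2:
  fixes \<alpha> :: "'a rel" and \<theta> :: "'b rel" and \<rho> :: "'c rel"
  assumes "Well_order \<alpha>" and "Well_order \<theta>"
    and "natLeq_on 1 \<le>o \<alpha>" and "\<alpha> \<le>o \<theta>" and "\<theta> <o cardSuc natLeq"
    and "is_Ramsey_number \<rho> \<alpha> (natLeq_on 3)" and "\<theta> <o \<rho>"
  shows "\<not> arrow_cl (omega_pow \<theta>) (omega_pow \<alpha>) (natLeq_on 3)"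
proof
  assume cl: "arrow_cl (omega_pow \<theta>) (omega_pow \<alpha>) (natLeq_on 3)"
  \<comment> \<open>Ranks, including the default rank of zero, need a nonempty \<theta> to take
    their values in.\<close>
  have "natLeq_on 1 \<le>o \<theta>" using assms(3,4) ordLeq_transitive by blast
  then obtain g where "embed (natLeq_on 1) \<theta> g" by (auto simp: ordLeq_def)
  then have "g ` Field (natLeq_on 1) \<subseteq> Field \<theta>" by (rule embed_Field)
  then have ne: "Field \<theta> \<noteq> {}" unfolding Field_natLeq_on by auto
  have "\<not> arrow \<theta> \<alpha> (natLeq_on 3)"
    using is_Ramsey_number_least[OF assms(6) assms(2)] assms(7) not_ordLess_ordLeq by blast
  then obtain c where c: "c \<in> [Field \<theta>]\<^bsup>2\<^esup> \<rightarrow> {0, 1::nat}"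
    and bad: "\<not> (\<exists>Y \<subseteq> Field \<theta>. (Restr \<theta> Y =o \<alpha> \<and> (\<forall>e \<in> [Y]\<^bsup>2\<^esup>. c e = 0)) \<or>
        (Restr \<theta> Y =o natLeq_on 3 \<and> (\<forall>e \<in> [Y]\<^bsup>2\<^esup>. c e = 1)))"
    unfolding arrow_def ball_simps(10) by (rule bexE)
  let ?rk = "cb_rank \<theta>"
  \<comment> \<open>The ranks of a pair form a set of one or two elements, and \<open>c\<close> is
    controlled only on sets of two.\<close>
  define d where "d e = (if card (?rk ` e) = 2 then c (?rk ` e) else 0)" for e
  have rk: "?rk ` X \<subseteq> Field \<theta>" if "X \<subseteq> fin_supp \<theta>" for X
    using that cb_rank_in_Field[OF assms(2) ne] by auto
  have "d e \<in> {0, 1}" if "e \<in> [Field (omega_pow \<theta>)]\<^bsup>2\<^esup>" for e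
  proof (cases "card (?rk ` e) = 2")
    case True
    have "e \<subseteq> fin_supp \<theta>" "finite e" using that by (auto simp: nsets_def Field_omega_pow)
    then have "?rk ` e \<in> [Field \<theta>]\<^bsup>2\<^esup>" using True rk by (auto simp: nsets_def)
    with c have "c (?rk ` e) \<in> {0, 1}" by (rule Pi_mem)
    with True show ?thesis by (simp add: d_def)
  qed (simp add: d_def)
  then have "d \<in> [Field (omega_pow \<theta>)]\<^bsup>2\<^esup> \<rightarrow> {0, 1}" by (rule Pi_I)
  from bspec[OF cl[unfolded arrow_cl_def] this] obtain X where X: "X \<subseteq> fin_supp \<theta>"
    and cases: "(closed_copy (omega_pow \<theta>) X (omega_pow \<alpha>) \<and> (\<forall>e \<in> [X]\<^bsup>2\<^esup>. d e = 0)) \<or>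
        (closed_copy (omega_pow \<theta>) X (natLeq_on 3) \<and> (\<forall>e \<in> [X]\<^bsup>2\<^esup>. d e = 1))"
    unfolding Field_omega_pow by (elim exE conjE)
  \<comment> \<open>Distinct ranks have distinct representatives in \<open>X\<close>, and on those
    \<open>d\<close> falls back on \<open>c\<close>.\<close>
  have lift: "\<exists>e' \<in> [X]\<^bsup>2\<^esup>. c e = d e'" if e: "e \<in> [?rk ` X]\<^bsup>2\<^esup>" for e
  proof -
    obtain x y where xy: "x \<in> X" "y \<in> X" "e = {?rk x, ?rk y}" "?rk x \<noteq> ?rk y"
      using e unfolding nsets_2_eq by auto
    then have "{x, y} \<in> [X]\<^bsup>2\<^esup>" "c e = d {x, y}"
      by (auto simp: d_def)
    then show ?thesis by blast
  qed
  from cases show False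
  proof
    assume A: "closed_copy (omega_pow \<theta>) X (omega_pow \<alpha>) \<and> (\<forall>e \<in> [X]\<^bsup>2\<^esup>. d e = 0)"
    then obtain M where M: "M \<subseteq> ?rk ` X" "Restr \<theta> M =o \<alpha>"
      using closed_copy_omega_pow_ranks[OF assms(1,2) ne] by blast
    have "c e = 0" if "e \<in> [M]\<^bsup>2\<^esup>" for e
    proof -
      have "e \<in> [?rk ` X]\<^bsup>2\<^esup>" using that M(1) by (auto simp: nsets_def)
      then show ?thesis using lift[of e] A by auto
    qed
    moreover have "M \<subseteq> Field \<theta>" using M(1) rk[OF X] by blast
    ultimately show False using bad M(2) by blast
  next
    assume A: "closed_copy (omega_pow \<theta>) X (natLeq_on 3) \<and> (\<forall>e \<in> [X]\<^bsup>2\<^esup>. d e = 1)"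
    then have X3: "finite X" "card X = 3"
      using closed_copy_natLeq_on_card[OF Well_order_omega_pow[OF assms(2)]] by blast+
    \<comment> \<open>A pair of equal ranks would have received colour 0, so the three points have
      three different ranks.\<close>
    have "inj_on ?rk X"
    proof (rule inj_onI, rule ccontr)
      fix x y assume "x \<in> X" "y \<in> X" "?rk x = ?rk y" "x \<noteq> y"
      then have "{x, y} \<in> [X]\<^bsup>2\<^esup>" "d {x, y} = 0" by (auto simp: nsets_def d_def)
      with A show False by auto
    qed
    then have "card (?rk ` X) = 3" using X3 by (simp add: card_image)
    then have "Restr \<theta> (?rk ` X) =o natLeq_on 3"
      using Restr_ordIso_natLeq_on_card[OF assms(2) rk[OF X]] X3(1) by simp
    moreover have "c e = 1" if "e \<in> [?rk ` X]\<^bsup>2\<^esup>" for e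
      using lift[OF that] A by auto
    ultimately show False using bad rk[OF X] by blast
  qed
qed

end
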